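(* Let $f:\Delta\to\Delta$ be the projective Cassaigne algorithm on the simplex $\Delta=\{(x,y,z)\in\mathbb{R}^3 \mid x>0,\ y>0,\ z>0,\ x+y+z=1\}$ (as defined in the context, up to a set of Lebesgue measure $0$). Then the function $$\delta(x,y,z)=\frac{1}{(1-x)(1-z)},\qquad z=1-x-y,$$ is the density, with respect to the Lebesgue measure $dx\,dy$ on $\Delta$, of an $f$-invariant measure; that is, the measure $\mu$ on $\Delta$ given by $d\mu=\delta\,dx\,dy$ satisfies $\mu(f^{-1}(B))=\mu(B)$ for every Borel set $B\subseteq\Delta$.
   Context: Let $\Lambda=\{(x,y,z)\in\mathbb{R}^3\mid x>0,y>0,z>0\}$, partitioned up to a set of Lebesgue measure zero into $\Lambda_a=\{(x,y,z)\in\Lambda\mid x>z\}$ and $\Lambda_b=\{(x,y,z)\in\Lambda\mid z>x\}$. The Cassaigne algorithm is the map $F$, defined almost everywhere on $\Lambda$, given by $F(x,y,z)=(x-z,z,y)$ on $\Lambda_a$ and $F(x,y,z)=(y,x,z-x)$ on $\Lambda_b$. Its projective version is $f:\Delta\to\Delta$, $f(\mathbf{x})=F(\mathbf{x})/\|F(\mathbf{x})\|_1$, where $\|(x,y,z)\|_1=|x|+|y|+|z|$; it is defined almost everywhere on $\Delta$. The coordinates on $\Delta$ are $(x,y)$, with $z=1-x-y$. *)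

theory Defs
  imports "HOL-Analysis.Analysis"
begin

definition Lambda :: "(real \<times> real \<times> real) set" where
  "Lambda = {(x, y, z). x > 0 \<and> y > 0 \<and> z > 0}"

definition Lambda_a :: "(real \<times> real \<times> real) set" where
  "Lambda_a = {(x, y, z). (x, y, z) \<in> Lambda \<and> x > z}"

definition Lambda_b :: "(real \<times> real \<times> real) set" where
  "Lambda_b = {(x, y, z). (x, y, z) \<in> Lambda \<and> z > x}"

(* F is meaningful only on the union of Lambda_a and Lambda_b, i.e. almost everywhere on Lambda.
   Elsewhere its value is arbitrary, so preimages must be intersected with the domain. *)
definition cassaigne_F :: "real \<times> real \<times> real \<Rightarrow> real \<times> real \<times> real" where
  "cassaigne_F p =
    (if p \<in> Lambda_a then (case p of (x, y, z) \<Rightarrow> (x - z, z, y))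
     else if p \<in> Lambda_b then (case p of (x, y, z) \<Rightarrow> (y, x, z - x))
     else undefined)"

(* The norm on the product type is the Euclidean one, hence a separate 1-norm. *)
definition norm1 :: "real \<times> real \<times> real \<Rightarrow> real" where
  "norm1 = (\<lambda>(x, y, z). \<bar>x\<bar> + \<bar>y\<bar> + \<bar>z\<bar>)"

definition Simplex :: "(real \<times> real \<times> real) set" where
  "Simplex = {(x, y, z). x > 0 \<and> y > 0 \<and> z > 0 \<and> x + y + z = 1}"

definition cassaigne_f :: "real \<times> real \<times> real \<Rightarrow> real \<times> real \<times> real" where
  "cassaigne_f p = cassaigne_F p /\<^sub>R norm1 (cassaigne_F p)"

definition cassaigne_f_dom :: "(real \<times> real \<times> real) set" where
  "cassaigne_f_dom = Simplex \<inter> (Lambda_a \<union> Lambda_b)"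

lemma normalize_in_Simplex:
  assumes "p \<in> Lambda"
  shows "p /\<^sub>R norm1 p \<in> Simplex"
proof -
  obtain x y z where p: "p = (x, y, z)" by (cases p)
  with assms have pos: "x > 0" "y > 0" "z > 0" by (auto simp: Lambda_def)
  then have n: "norm1 p = x + y + z" by (simp add: p norm1_def)
  have "x / (x + y + z) + y / (x + y + z) + z / (x + y + z) = (x + y + z) / (x + y + z)"
    by (simp only: add_divide_distrib)
  also have "\<dots> = 1" using pos by simp
  finally show ?thesis
    using pos by (simp add: n) (simp add: p Simplex_def divide_inverse mult.commute)
qed

lemma cassaigne_f_in_Simplex:
  assumes "p \<in> cassaigne_f_dom"
  shows "cassaigne_f p \<in> Simplex"
  unfolding cassaigne_f_def
  by (rule normalize_in_Simplex)
    (use assms in \<open>auto simp: cassaigne_f_dom_def Lambda_a_def Lambda_b_def Lambda_def cassaigne_F_def\<close>)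

definition simplex_point :: "real \<times> real \<Rightarrow> real \<times> real \<times> real" where
  "simplex_point = (\<lambda>(x, y). (x, y, 1 - x - y))"

(* The measure dx dy on the simplex: planar Lebesgue measure on the set of coordinate pairs (x, y),
   transported by the chart. Its measurable sets are the Borel subsets of the simplex. *)
definition simplex_lebesgue :: "(real \<times> real \<times> real) measure" where
  "simplex_lebesgue =
    distr (restrict_space lborel (simplex_point -` Simplex)) (restrict_space borel Simplex)
      simplex_point"

definition cassaigne_delta :: "real \<times> real \<times> real \<Rightarrow> real" where
  "cassaigne_delta = (\<lambda>(x, y, z). 1 / ((1 - x) * (1 - z)))"

definition cassaigne_measure :: "(real \<times> real \<times> real) measure" where
  "cassaigne_measure = density simplex_lebesgue (\<lambda>p. ennreal (cassaigne_delta p))"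

lemma measurable_simplex_point [measurable]: "simplex_point \<in> borel_measurable borel"
  unfolding simplex_point_def case_prod_beta
  by (intro borel_measurable_continuous_onI continuous_intros)

lemma Simplex_borel [measurable]: "Simplex \<in> sets borel"
proof -
  have "Simplex = {p. 0 < fst p} \<inter> {p. 0 < fst (snd p)} \<inter> {p. 0 < snd (snd p)}
      \<inter> {p. fst p + fst (snd p) + snd (snd p) = 1}"
    by (auto simp: Simplex_def)
  also have "\<dots> \<in> sets borel"
    by (intro sets.Int borel_open borel_closed open_Collect_less closed_Collect_eq continuous_intros)
  finally show ?thesis .
qed

lemma simplex_vimage_borel [measurable]: "simplex_point -` Simplex \<in> sets borel"
  using measurable_sets[OF measurable_simplex_point Simplex_borel] by simp

lemma sets_cassaigne_measure:
  "A \<in> sets cassaigne_measure \<longleftrightarrow> A \<in> sets borel \<and> A \<subseteq> Simplex"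
  by (auto simp: cassaigne_measure_def simplex_lebesgue_def sets_restrict_space_iff)

lemma emeasure_cassaigne_measure:
  assumes "B \<in> sets borel" "B \<subseteq> Simplex"
  shows "emeasure cassaigne_measure B =
    (\<integral>\<^sup>+(x, y). ennreal (1 / ((1 - x) * (1 - (1 - x - y)))) * indicator B (x, y, 1 - x - y) \<partial>lborel)"
proof -
  have m: "simplex_point \<in> restrict_space lborel (simplex_point -` Simplex)
      \<rightarrow>\<^sub>M restrict_space borel Simplex"
    by (intro measurable_restrict_space3) auto
  have d: "cassaigne_delta \<in> borel_measurable borel"
    unfolding cassaigne_delta_def case_prod_beta
    by (intro borel_measurable_divide borel_measurable_times borel_measurable_continuous_onI
        continuous_intros)
  have dr: "(\<lambda>p. ennreal (cassaigne_delta p)) \<in> borel_measurable (restrict_space borel Simplex)"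
    by (intro measurable_restrict_space1 measurable_compose[OF d measurable_ennreal])
  have B: "B \<in> sets (restrict_space borel Simplex)"
    using assms by (auto simp: sets_restrict_space_iff)
  have db: "(\<lambda>p. ennreal (cassaigne_delta p) * indicator B p)
      \<in> borel_measurable (restrict_space borel Simplex)"
    using dr B by (intro borel_measurable_times_ennreal borel_measurable_indicator) auto
  have "emeasure cassaigne_measure B =
      (\<integral>\<^sup>+p. ennreal (cassaigne_delta p) * indicator B p \<partial>simplex_lebesgue)"
    unfolding cassaigne_measure_def using dr B
    by (subst emeasure_density) (auto simp: simplex_lebesgue_def)
  also have "\<dots> = (\<integral>\<^sup>+q. ennreal (cassaigne_delta (simplex_point q)) * indicator B (simplex_point q)
      \<partial>restrict_space lborel (simplex_point -` Simplex))"
    unfolding simplex_lebesgue_def using m db by (subst nn_integral_distr) auto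
  also have "\<dots> = (\<integral>\<^sup>+q. ennreal (cassaigne_delta (simplex_point q)) * indicator B (simplex_point q)
      * indicator (simplex_point -` Simplex) q \<partial>lborel)"
    by (subst nn_integral_restrict_space) auto
  also have "\<dots> = (\<integral>\<^sup>+(x, y). ennreal (1 / ((1 - x) * (1 - (1 - x - y))))
      * indicator B (x, y, 1 - x - y) \<partial>lborel)"
    using assms(2)
    by (intro nn_integral_cong) (auto simp: cassaigne_delta_def simplex_point_def indicator_def)
  finally show ?thesis .
qed

end

theory Submission
  imports Defs
begin

text \<open>
  The idea is the transfer-operator identity. On the half \<open>x > z\<close> of the simplex the projective map
  is a bijection onto the simplex, with inverse branch
  \<open>(u, v, w) \<mapsto> (u + v, w, v) / (1 + v)\<close>; its Jacobian in the plane coordinates is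
  \<open>1 / (1 + v)\<^sup>3\<close>, and the density at the image point is \<open>(1 + v)\<^sup>2 / (1 - u)\<close>. Hence this half
  contributes the density \<open>1 / ((1 - u) * (1 + v))\<close> to the image of the measure. The exchange of
  the first and last coordinates conjugates the two halves of the map, and preserves both the
  Lebesgue measure and the density, so the half \<open>z > x\<close> contributes \<open>1 / ((1 - w) * (1 + v))\<close>. As
  \<open>(1 - u) + (1 - w) = 1 + v\<close> on the simplex, the two contributions add up to
  \<open>1 / ((1 - u) * (1 - w))\<close>, the density itself.

  The change of variables splits into one-dimensional ones: with \<open>(u, v)\<close> as coordinates of the
  argument and \<open>(x, z)\<close> as coordinates of the value, the inverse branch is triangular, since
  \<open>z = v / (1 + v)\<close> depends on \<open>v\<close> alone, and \<open>x = (u + v) / (1 + v)\<close> is affine in \<open>u\<close> for fixed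
  \<open>v\<close>. Tonelli's theorem therefore reduces it to one affine and one smooth monotone substitution
  (lemma \<open>simplex_integral_branch_substitution\<close>).
\<close>

section \<open>Integration over the plane of the simplex\<close>

text \<open>
  The integral extends over the whole affine plane \<open>x + y + z = 1\<close>, not just the simplex: the
  domain is carried by the integrand, so that substitutions need not track its image.
\<close>

definition simplex_integral :: "(real \<times> real \<times> real \<Rightarrow> ennreal) \<Rightarrow> ennreal" where
  "simplex_integral k = (\<integral>\<^sup>+q. k (simplex_point q) \<partial>lborel)"

definition swap_ends :: "real \<times> real \<times> real \<Rightarrow> real \<times> real \<times> real" where
  "swap_ends = (\<lambda>(x, y, z). (z, y, x))"

lemma measurable_triple:
  assumes "f \<in> borel_measurable M" "g \<in> borel_measurable M" "h \<in> borel_measurable M"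
  shows "(\<lambda>p. (f p, g p, h p) :: real \<times> real \<times> real) \<in> borel_measurable M"
  using assms by (intro borel_measurable_Pair)

lemma measurable_coordinates [measurable]:
  "(fst :: real \<times> real \<times> real \<Rightarrow> real) \<in> borel_measurable borel"
  "(\<lambda>p :: real \<times> real \<times> real. fst (snd p)) \<in> borel_measurable borel"
  "(\<lambda>p :: real \<times> real \<times> real. snd (snd p)) \<in> borel_measurable borel"
  by (intro borel_measurable_continuous_onI continuous_intros)+

lemma measurable_swap_ends [measurable]: "swap_ends \<in> borel_measurable borel"
  unfolding swap_ends_def case_prod_beta by (intro measurable_triple measurable_coordinates)

lemma measurable_cassaigne_delta [measurable]: "cassaigne_delta \<in> borel_measurable borel"
  unfolding cassaigne_delta_def case_prod_beta by measurable

lemma simplex_integral_iterated_x_y: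
  assumes [measurable]: "k \<in> borel_measurable borel"
  shows "simplex_integral k = (\<integral>\<^sup>+y. \<integral>\<^sup>+x. k (x, y, 1 - x - y) \<partial>lborel \<partial>lborel)"
proof -
  have "(\<lambda>q. k (simplex_point q)) \<in> borel_measurable (lborel \<Otimes>\<^sub>M lborel)"
    unfolding lborel_prod by measurable
  from lborel_pair.nn_integral_snd[OF this] show ?thesis
    by (simp add: simplex_integral_def lborel_prod simplex_point_def)
qed

text \<open>
  For fixed \<open>x\<close> the change of chart is the reflection \<open>y \<mapsto> 1 - x - y\<close>, so \<open>dx dy\<close> and \<open>dx dz\<close>
  agree on the plane. This chart makes the inverse branch below triangular.
\<close>

lemma simplex_integral_iterated_x_z:
  assumes [measurable]: "k \<in> borel_measurable borel"
  shows "simplex_integral k = (\<integral>\<^sup>+z. \<integral>\<^sup>+x. k (x, 1 - x - z, z) \<partial>lborel \<partial>lborel)"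
proof -
  have m: "(\<lambda>q. k (simplex_point q)) \<in> borel_measurable (lborel \<Otimes>\<^sub>M lborel)"
    unfolding lborel_prod by measurable
  have tri: "(\<lambda>q :: real \<times> real. (fst q, 1 - fst q - snd q, snd q)) \<in> borel_measurable borel"
    by (intro borel_measurable_continuous_onI continuous_intros)
  have m': "(\<lambda>(x, z). k (x, 1 - x - z, z)) \<in> borel_measurable (lborel \<Otimes>\<^sub>M lborel)"
    unfolding lborel_prod using measurable_compose[OF tri assms] by (simp add: case_prod_beta)
  have "simplex_integral k = (\<integral>\<^sup>+x. \<integral>\<^sup>+y. k (x, y, 1 - x - y) \<partial>lborel \<partial>lborel)"
    using lborel.nn_integral_fst[OF m]
    by (simp add: simplex_integral_def lborel_prod simplex_point_def)
  also have "\<dots> = (\<integral>\<^sup>+x. \<integral>\<^sup>+z. k (x, 1 - x - z, z) \<partial>lborel \<partial>lborel)"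
  proof (rule nn_integral_cong)
    fix x :: real
    have t: "(\<lambda>y. (x, y, 1 - x - y)) \<in> borel_measurable borel"
      by (intro borel_measurable_continuous_onI continuous_intros)
    from nn_integral_real_affine[OF measurable_compose[OF t assms], of "- 1" "1 - x"]
    show "(\<integral>\<^sup>+y. k (x, y, 1 - x - y) \<partial>lborel) = (\<integral>\<^sup>+z. k (x, 1 - x - z, z) \<partial>lborel)"
      by simp
  qed
  also have "\<dots> = (\<integral>\<^sup>+z. \<integral>\<^sup>+x. k (x, 1 - x - z, z) \<partial>lborel \<partial>lborel)"
    by (rule lborel_pair.Fubini'[OF m', symmetric])
  finally show ?thesis .
qed

text \<open>For fixed \<open>y\<close> the exchange acts on \<open>x\<close> as the reflection \<open>x \<mapsto> 1 - y - x\<close>.\<close>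

lemma simplex_integral_swap_ends:
  assumes [measurable]: "k \<in> borel_measurable borel"
  shows "simplex_integral (\<lambda>p. k (swap_ends p)) = simplex_integral k"
proof -
  have inner: "(\<integral>\<^sup>+x. k (x, y, 1 - x - y) \<partial>lborel) = (\<integral>\<^sup>+x. k (1 - x - y, y, x) \<partial>lborel)" for y :: real
  proof -
    have t: "(\<lambda>x. (x, y, 1 - x - y)) \<in> borel_measurable borel"
      by (intro borel_measurable_continuous_onI continuous_intros)
    from nn_integral_real_affine[OF measurable_compose[OF t assms], of "- 1" "1 - y"]
    show ?thesis by (simp add: algebra_simps)
  qed
  have [measurable]: "(\<lambda>p. k (swap_ends p)) \<in> borel_measurable borel" by measurable
  show ?thesis
    by (simp add: simplex_integral_iterated_x_y inner) (simp add: swap_ends_def)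
qed

section \<open>The inverse branch on the half with larger first coordinate\<close>

text \<open>
  On the plane \<open>u + v + w = 1\<close> the linear inverse of \<open>(x, y, z) \<mapsto> (x - z, z, y)\<close> sends
  \<open>(u, v, w)\<close> to \<open>(u + v, w, v)\<close>, whose coordinates add up to \<open>1 + v\<close>: the denominator is the
  normalization.
\<close>

definition inverse_branch :: "real \<times> real \<times> real \<Rightarrow> real \<times> real \<times> real" where
  "inverse_branch = (\<lambda>(u, v, w). ((u + v) / (1 + v), w / (1 + v), v / (1 + v)))"

lemma measurable_inverse_branch [measurable]: "inverse_branch \<in> borel_measurable borel"
  unfolding inverse_branch_def case_prod_beta by (intro measurable_triple) measurable

text \<open>
  The factor \<open>1 / (1 + v)\<^sup>3\<close> is the product of \<open>1 / (1 + v)\<^sup>2\<close>, the derivative of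
  \<open>v \<mapsto> v / (1 + v)\<close>, and of \<open>1 / (1 + v)\<close>, the slope of \<open>u \<mapsto> (u + v) / (1 + v)\<close>. The interval
  \<open>{0..1/2}\<close> contains the values of \<open>z\<close> on the simplex where \<open>z < x\<close>, and is the image of \<open>{0..1}\<close>.
\<close>

lemma simplex_integral_branch_substitution:
  assumes k [measurable]: "k \<in> borel_measurable borel"
    and supp: "\<And>x y z. z \<notin> {0..1/2} \<Longrightarrow> k (x, y, z) = 0"
  shows "simplex_integral k =
    simplex_integral (\<lambda>(u, v, w). ennreal (1 / (1 + v) ^ 3) * k (inverse_branch (u, v, w))
      * indicator {0..1} v)"
proof -
  define J where "J z = (\<integral>\<^sup>+x. k (x, 1 - x - z, z) \<partial>lborel)" for z
  have tri: "(\<lambda>q :: real \<times> real. (snd q, 1 - snd q - fst q, fst q)) \<in> borel_measurable borel"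
    by (intro borel_measurable_continuous_onI continuous_intros)
  have "(\<lambda>q. k (snd q, 1 - snd q - fst q, fst q)) \<in> borel_measurable (lborel \<Otimes>\<^sub>M lborel)"
    unfolding lborel_prod using measurable_compose[OF tri k] by simp
  then have J [measurable]: "J \<in> borel_measurable borel"
    using lborel.borel_measurable_nn_integral_fst by (fastforce simp: J_def[abs_def])
  have inner: "J (v / (1 + v)) * ennreal (1 / (1 + v)\<^sup>2) =
      (\<integral>\<^sup>+u. ennreal (1 / (1 + v) ^ 3) * k (inverse_branch (u, v, 1 - u - v)) \<partial>lborel)"
    if v: "v \<in> {0..1}" for v :: real
  proof -
    from v have pos: "1 + v > 0" by simp
    have t: "(\<lambda>x. (x, 1 - x - v / (1 + v), v / (1 + v))) \<in> borel_measurable borel"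
      by (intro borel_measurable_continuous_onI continuous_intros)
    have m: "(\<lambda>u. k (inverse_branch (u, v, 1 - u - v))) \<in> borel_measurable lborel"
    proof -
      have "(\<lambda>u. (u, v, 1 - u - v)) \<in> borel_measurable borel"
        by (intro borel_measurable_continuous_onI continuous_intros)
      from measurable_compose[OF measurable_compose[OF this measurable_inverse_branch] k]
      show ?thesis by simp
    qed
    have eq: "(v / (1 + v) + 1 / (1 + v) * u, 1 - (v / (1 + v) + 1 / (1 + v) * u) - v / (1 + v),
        v / (1 + v)) = inverse_branch (u, v, 1 - u - v)" for u
    proof -
      have "v / (1 + v) + 1 / (1 + v) * u = (u + v) / (1 + v)"
        by (simp add: add_divide_distrib)
      moreover have "1 - (u + v) / (1 + v) - v / (1 + v) = (1 - u - v) / (1 + v)"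
      proof -
        have "1 - (u + v) / (1 + v) - v / (1 + v) = ((1 + v) - (u + v) - v) / (1 + v)"
          using pos by (simp only: diff_divide_distrib) simp
        then show ?thesis by (simp add: algebra_simps)
      qed
      ultimately show ?thesis by (simp add: inverse_branch_def)
    qed
    have "J (v / (1 + v)) =
        ennreal (1 / (1 + v)) * (\<integral>\<^sup>+u. k (inverse_branch (u, v, 1 - u - v)) \<partial>lborel)"
      unfolding J_def
      using nn_integral_real_affine[OF measurable_compose[OF t k], of "1 / (1 + v)" "v / (1 + v)"] pos
      by (simp only: eq) simp
    moreover have "ennreal (1 / (1 + v) ^ 3) = ennreal (1 / (1 + v)) * ennreal (1 / (1 + v)\<^sup>2)"
      using pos by (simp add: ennreal_mult[symmetric] power2_eq_square power3_eq_cube)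
    ultimately show ?thesis
      using m by (simp add: nn_integral_cmult mult_ac)
  qed
  have "simplex_integral k = (\<integral>\<^sup>+z. J z * indicator {0..1/2} z \<partial>lborel)"
    unfolding simplex_integral_iterated_x_z[OF k] J_def
    by (intro nn_integral_cong) (auto simp: supp indicator_def)
  also have "\<dots> = (\<integral>\<^sup>+v. J (v / (1 + v)) * ennreal (1 / (1 + v)\<^sup>2) * indicator {0..1} v \<partial>lborel)"
  proof -
    have "((\<lambda>v. v / (1 + v)) has_real_derivative 1 / (1 + v)\<^sup>2) (at v)" if "v \<in> {0..1}" for v :: real
      using that by (auto intro!: derivative_eq_intros simp: field_simps power2_eq_square)
    moreover have "continuous_on {0..1} (\<lambda>v::real. 1 / (1 + v)\<^sup>2)"
      by (intro continuous_intros) auto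
    ultimately show ?thesis
      using nn_integral_substitution_aux[of J 0 1 "\<lambda>v. v / (1 + v)" "\<lambda>v. 1 / (1 + v)\<^sup>2"] by simp
  qed
  also have "\<dots> = (\<integral>\<^sup>+v. \<integral>\<^sup>+u. ennreal (1 / (1 + v) ^ 3) * k (inverse_branch (u, v, 1 - u - v))
      * indicator {0..1} v \<partial>lborel \<partial>lborel)"
    by (intro nn_integral_cong) (auto simp: inner indicator_def)
  also have "\<dots> = simplex_integral (\<lambda>(u, v, w). ennreal (1 / (1 + v) ^ 3)
      * k (inverse_branch (u, v, w)) * indicator {0..1} v)"
  proof -
    have "(\<lambda>(u, v, w). ennreal (1 / (1 + v) ^ 3) * k (inverse_branch (u, v, w))
        * indicator {0..1} v) \<in> borel_measurable borel"
      unfolding case_prod_beta by simp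
    then show ?thesis by (simp add: simplex_integral_iterated_x_y)
  qed
  finally show ?thesis .
qed

section \<open>The preimage in each half of the simplex\<close>

definition preimage_a :: "(real \<times> real \<times> real) set \<Rightarrow> (real \<times> real \<times> real) set" where
  "preimage_a B = cassaigne_f -` B \<inter> (Simplex \<inter> Lambda_a)"

definition preimage_b :: "(real \<times> real \<times> real) set \<Rightarrow> (real \<times> real \<times> real) set" where
  "preimage_b B = cassaigne_f -` B \<inter> (Simplex \<inter> Lambda_b)"

lemma Lambda_a_borel [measurable]: "Lambda_a \<in> sets borel"
proof -
  have "Lambda_a = {p. 0 < fst p} \<inter> {p. 0 < fst (snd p)} \<inter> {p. 0 < snd (snd p)}
      \<inter> {p. snd (snd p) < fst p}"
    by (auto simp: Lambda_a_def Lambda_def)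
  also have "\<dots> \<in> sets borel"
    by (intro sets.Int borel_open open_Collect_less continuous_intros)
  finally show ?thesis .
qed

text \<open>The norm of \<open>(x - z, z, y)\<close> is \<open>x + y\<close>, which is \<open>1 - z\<close> on the simplex.\<close>

lemma cassaigne_f_on_Lambda_a:
  assumes "(x, y, z) \<in> Simplex \<inter> Lambda_a"
  shows "cassaigne_f (x, y, z) = ((x - z) / (1 - z), z / (1 - z), y / (1 - z))"
proof -
  from assms have "norm1 (cassaigne_F (x, y, z)) = 1 - z"
    by (auto simp: norm1_def cassaigne_F_def Simplex_def Lambda_a_def)
  with assms show ?thesis
    by (simp add: cassaigne_f_def cassaigne_F_def divide_inverse mult.commute)
qed

lemma preimage_a_borel:
  assumes [measurable]: "B \<in> sets borel"
  shows "preimage_a B \<in> sets borel"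
proof -
  define h :: "real \<times> real \<times> real \<Rightarrow> real \<times> real \<times> real" where
    "h p = ((fst p - snd (snd p)) / (1 - snd (snd p)), snd (snd p) / (1 - snd (snd p)),
      fst (snd p) / (1 - snd (snd p)))" for p
  have "h \<in> borel_measurable borel"
    unfolding h_def by (intro measurable_triple) measurable
  from measurable_sets[OF this assms] have "h -` B \<in> sets borel" by simp
  moreover have "preimage_a B = h -` B \<inter> (Simplex \<inter> Lambda_a)"
    by (auto simp: preimage_a_def h_def cassaigne_f_on_Lambda_a)
  ultimately show ?thesis by simp
qed

text \<open>
  The exchange of the end coordinates conjugates the two halves of the map. All facts about the half
  \<open>z > x\<close> are deduced from the half \<open>x > z\<close> through this identity.
\<close>

lemma preimage_b_eq_swap: "preimage_b B = swap_ends -` preimage_a (swap_ends -` B)"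
proof -
  have "cassaigne_f (x, y, z) = swap_ends (cassaigne_f (z, y, x))"
    if "(x, y, z) \<in> Lambda_b" for x y z
    using that
    by (auto simp: cassaigne_f_def cassaigne_F_def swap_ends_def Lambda_a_def Lambda_b_def
        Lambda_def norm1_def add_ac)
  then show ?thesis
    by (auto simp: preimage_a_def preimage_b_def swap_ends_def Simplex_def Lambda_a_def
        Lambda_b_def Lambda_def add_ac)
qed

lemma preimage_b_borel:
  assumes "B \<in> sets borel"
  shows "preimage_b B \<in> sets borel"
proof -
  have "swap_ends -` C \<in> sets borel" if "C \<in> sets borel" for C
    using measurable_sets[OF measurable_swap_ends that] by simp
  then show ?thesis
    using assms by (simp add: preimage_b_eq_swap preimage_a_borel)
qed

text \<open>
  This turns the indicator of the preimage, after substituting the inverse branch, into the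
  indicator of \<open>B\<close>. The points with \<open>v \<ge> 0\<close> outside the simplex are included because the
  substitution ranges over a whole strip of the plane: their images miss the half \<open>x > z\<close> of the
  simplex, since a positive multiple of the image is \<open>(u + v, w, v)\<close>.
\<close>

lemma inverse_branch_in_preimage_a_iff:
  assumes "B \<subseteq> Simplex" "u + v + w = 1" "0 \<le> v"
  shows "inverse_branch (u, v, w) \<in> preimage_a B \<longleftrightarrow> (u, v, w) \<in> B"
proof -
  let ?p = "inverse_branch (u, v, w)"
  have "?p \<in> Simplex \<inter> Lambda_a \<longleftrightarrow> (u, v, w) \<in> Simplex"
  proof -
    have "(u + v) / (1 + v) + w / (1 + v) + v / (1 + v) = 1"
      using assms by (simp add: add_divide_distrib[symmetric])
    then show ?thesis
      using assms
      by (auto simp: inverse_branch_def Simplex_def Lambda_a_def Lambda_def zero_less_divide_iff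
          divide_strict_right_mono divide_less_cancel)
  qed
  moreover have "cassaigne_f ?p = (u, v, w)" if "?p \<in> Simplex \<inter> Lambda_a"
  proof -
    have "1 - v / (1 + v) = 1 / (1 + v)" "(u + v) / (1 + v) - v / (1 + v) = u / (1 + v)"
      using assms(3) by (simp add: field_simps) (simp add: diff_divide_distrib[symmetric])
    then show ?thesis
      using cassaigne_f_on_Lambda_a[OF that[unfolded inverse_branch_def prod.case]] assms(3)
      by (simp add: inverse_branch_def)
  qed
  ultimately show ?thesis
    using assms(1) by (auto simp: preimage_a_def)
qed

section \<open>The two contributions to the density\<close>

lemma emeasure_cassaigne_measure_simplex_integral:
  assumes "B \<in> sets borel" "B \<subseteq> Simplex"
  shows "emeasure cassaigne_measure B =
    simplex_integral (\<lambda>p. ennreal (cassaigne_delta p) * indicator B p)"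
  unfolding emeasure_cassaigne_measure[OF assms] simplex_integral_def
  by (intro nn_integral_cong) (auto simp: simplex_point_def cassaigne_delta_def)

text \<open>
  At \<open>inverse_branch (u, v, w)\<close> the factors \<open>1 - x\<close> and \<open>1 - z\<close> are \<open>(1 - u) / (1 + v)\<close> and
  \<open>1 / (1 + v)\<close>, so two of the three factors \<open>1 + v\<close> of the Jacobian cancel.
\<close>

lemma emeasure_preimage_a:
  assumes B: "B \<in> sets borel" "B \<subseteq> Simplex"
  shows "emeasure cassaigne_measure (preimage_a B) =
    simplex_integral (\<lambda>(u, v, w). ennreal (1 / ((1 - u) * (1 + v))) * indicator B (u, v, w))"
proof -
  let ?k = "\<lambda>p. ennreal (cassaigne_delta p) * indicator (preimage_a B) p"
  note [measurable] = preimage_a_borel[OF B(1)]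
  have "emeasure cassaigne_measure (preimage_a B) = simplex_integral ?k"
    by (intro emeasure_cassaigne_measure_simplex_integral preimage_a_borel B)
      (auto simp: preimage_a_def)
  also have "\<dots> = simplex_integral (\<lambda>(u, v, w). ennreal (1 / (1 + v) ^ 3)
      * ?k (inverse_branch (u, v, w)) * indicator {0..1} v)"
  proof (rule simplex_integral_branch_substitution)
    show "?k \<in> borel_measurable borel" by measurable
    show "?k (x, y, z) = 0" if "z \<notin> {0..1/2}" for x y z
      using that by (auto simp: indicator_def preimage_a_def Simplex_def Lambda_a_def)
  qed
  also have "\<dots> = simplex_integral (\<lambda>(u, v, w). ennreal (1 / ((1 - u) * (1 + v)))
      * indicator B (u, v, w))"
    unfolding simplex_integral_def
  proof (intro nn_integral_cong, clarsimp simp: simplex_point_def)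
    fix u v :: real
    let ?w = "1 - u - v"
    show "ennreal (1 / (1 + v) ^ 3) * (ennreal (cassaigne_delta (inverse_branch (u, v, ?w)))
        * indicator (preimage_a B) (inverse_branch (u, v, ?w))) * indicator {0..1} v =
        ennreal (1 / ((1 - u) * (1 + v))) * indicator B (u, v, ?w)"
    proof (cases "(u, v, ?w) \<in> B")
      case True
      with B(2) have uv: "0 < u" "u < 1" "0 < v" "v < 1" by (auto simp: Simplex_def)
      have "1 - (u + v) / (1 + v) = (1 - u) / (1 + v)" "1 - v / (1 + v) = 1 / (1 + v)"
        using uv by (simp_all add: field_simps)
      then have "cassaigne_delta (inverse_branch (u, v, ?w)) = (1 + v)\<^sup>2 / (1 - u)"
        by (simp add: cassaigne_delta_def inverse_branch_def power2_eq_square)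
      moreover have "1 / (1 + v) ^ 3 * ((1 + v)\<^sup>2 / (1 - u)) = 1 / ((1 - u) * (1 + v))"
        using uv by (simp add: power2_eq_square power3_eq_cube)
      ultimately show ?thesis
        using True uv inverse_branch_in_preimage_a_iff[OF B(2), of u v ?w]
        by (simp add: ennreal_mult[symmetric])
    next
      case False
      then show ?thesis
        using inverse_branch_in_preimage_a_iff[OF B(2), of u v ?w] by (auto simp: indicator_def)
    qed
  qed
  finally show ?thesis .
qed

text \<open>The density is symmetric in \<open>x\<close> and \<open>z\<close>.\<close>

lemma emeasure_cassaigne_measure_swap_ends:
  assumes B: "B \<in> sets borel" "B \<subseteq> Simplex"
  shows "emeasure cassaigne_measure (swap_ends -` B) = emeasure cassaigne_measure B"
proof -
  have "swap_ends -` B \<in> sets borel"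
    using measurable_sets[OF measurable_swap_ends B(1)] by simp
  moreover have "swap_ends -` B \<subseteq> Simplex"
    using B(2) by (auto simp: swap_ends_def Simplex_def)
  ultimately have "emeasure cassaigne_measure (swap_ends -` B) =
      simplex_integral (\<lambda>p. ennreal (cassaigne_delta p) * indicator (swap_ends -` B) p)"
    by (rule emeasure_cassaigne_measure_simplex_integral)
  also have "\<dots> = simplex_integral
      (\<lambda>p. ennreal (cassaigne_delta (swap_ends p)) * indicator B (swap_ends p))"
    by (intro arg_cong[where f = simplex_integral] ext)
      (auto simp: cassaigne_delta_def swap_ends_def indicator_def mult.commute)
  also have "\<dots> = simplex_integral (\<lambda>p. ennreal (cassaigne_delta p) * indicator B p)"
    by (rule simplex_integral_swap_ends) (use B(1) in measurable)
  finally show ?thesis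
    by (simp add: emeasure_cassaigne_measure_simplex_integral[OF B])
qed

lemma emeasure_preimage_b:
  assumes B: "B \<in> sets borel" "B \<subseteq> Simplex"
  shows "emeasure cassaigne_measure (preimage_b B) =
    simplex_integral (\<lambda>(u, v, w). ennreal (1 / ((1 - w) * (1 + v))) * indicator B (u, v, w))"
proof -
  let ?C = "swap_ends -` B"
  let ?k = "\<lambda>(u, v, w). ennreal (1 / ((1 - w) * (1 + v))) * indicator B (u, v, w)"
  have C: "?C \<in> sets borel" "?C \<subseteq> Simplex"
    using measurable_sets[OF measurable_swap_ends B(1)] B(2)
    by (auto simp: swap_ends_def Simplex_def)
  have k: "?k \<in> borel_measurable borel"
    unfolding case_prod_beta prod.collapse using B(1) by measurable
  have "emeasure cassaigne_measure (preimage_b B) = emeasure cassaigne_measure (preimage_a ?C)"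
    unfolding preimage_b_eq_swap
    by (rule emeasure_cassaigne_measure_swap_ends[OF preimage_a_borel[OF C(1)]])
      (auto simp: preimage_a_def)
  also have "\<dots> = simplex_integral (\<lambda>p. ?k (swap_ends p))"
    unfolding emeasure_preimage_a[OF C]
    by (intro arg_cong[where f = simplex_integral] ext)
      (auto simp: swap_ends_def indicator_def)
  also have "\<dots> = simplex_integral ?k"
    by (rule simplex_integral_swap_ends[OF k])
  finally show ?thesis .
qed

theorem proposition22:
  fixes B :: "(real \<times> real \<times> real) set"
  assumes "B \<in> sets borel" and "B \<subseteq> Simplex"
  shows "cassaigne_f -` B \<inter> cassaigne_f_dom \<in> sets cassaigne_measure \<and>
    emeasure cassaigne_measure (cassaigne_f -` B \<inter> cassaigne_f_dom) = emeasure cassaigne_measure B"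
proof
  let ?ka = "\<lambda>(u, v, w). ennreal (1 / ((1 - u) * (1 + v))) * indicator B (u, v, w)"
  let ?kb = "\<lambda>(u, v, w). ennreal (1 / ((1 - w) * (1 + v))) * indicator B (u, v, w)"
  have split: "cassaigne_f -` B \<inter> cassaigne_f_dom = preimage_a B \<union> preimage_b B"
    by (auto simp: cassaigne_f_dom_def preimage_a_def preimage_b_def)
  have disjoint: "preimage_a B \<inter> preimage_b B = {}"
    by (auto simp: preimage_a_def preimage_b_def Lambda_a_def Lambda_b_def)
  have sets: "preimage_a B \<in> sets cassaigne_measure" "preimage_b B \<in> sets cassaigne_measure"
    using preimage_a_borel[OF assms(1)] preimage_b_borel[OF assms(1)]
    by (auto simp: sets_cassaigne_measure) (auto simp: preimage_a_def preimage_b_def)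
  then show "cassaigne_f -` B \<inter> cassaigne_f_dom \<in> sets cassaigne_measure"
    unfolding split by auto
  have k: "?ka \<in> borel_measurable borel" "?kb \<in> borel_measurable borel"
    unfolding case_prod_beta prod.collapse using assms(1) by measurable
  have "emeasure cassaigne_measure (cassaigne_f -` B \<inter> cassaigne_f_dom) =
      emeasure cassaigne_measure (preimage_a B) + emeasure cassaigne_measure (preimage_b B)"
    unfolding split using plus_emeasure[OF sets disjoint] by simp
  also have "\<dots> = simplex_integral ?ka + simplex_integral ?kb"
    by (simp only: emeasure_preimage_a[OF assms] emeasure_preimage_b[OF assms])
  also have "\<dots> = simplex_integral (\<lambda>p. ?ka p + ?kb p)"
    unfolding simplex_integral_def
    using measurable_compose[OF measurable_simplex_point k(1)]
      measurable_compose[OF measurable_simplex_point k(2)]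
    by (subst nn_integral_add) auto
  also have "\<dots> = simplex_integral (\<lambda>p. ennreal (cassaigne_delta p) * indicator B p)"
    unfolding simplex_integral_def
  proof (rule nn_integral_cong)
    fix q :: "real \<times> real"
    obtain u v where q: "q = (u, v)" by (cases q)
    let ?w = "1 - u - v"
    have "ennreal (1 / ((1 - u) * (1 + v))) * indicator B (u, v, ?w)
        + ennreal (1 / ((1 - ?w) * (1 + v))) * indicator B (u, v, ?w) =
        ennreal (cassaigne_delta (u, v, ?w)) * indicator B (u, v, ?w)"
    proof (cases "(u, v, ?w) \<in> B")
      case True
      with assms(2) have uv: "0 < 1 - u" "0 < 1 + v" "0 < 1 - ?w" by (auto simp: Simplex_def)
      have "1 / ((1 - u) * (1 + v)) + 1 / ((1 - ?w) * (1 + v)) =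
          ((1 - ?w) + (1 - u)) / ((1 - u) * (1 - ?w) * (1 + v))"
        using uv by (simp only: add_divide_distrib) simp
      also have "(1 - ?w) + (1 - u) = 1 + v" by simp
      also have "(1 + v) / ((1 - u) * (1 - ?w) * (1 + v)) = cassaigne_delta (u, v, ?w)"
        using uv by (simp add: cassaigne_delta_def)
      finally show ?thesis
        using True uv by (simp add: ennreal_plus[symmetric] del: ennreal_plus)
    qed simp
    then show "?ka (simplex_point q) + ?kb (simplex_point q) =
        ennreal (cassaigne_delta (simplex_point q)) * indicator B (simplex_point q)"
      by (simp add: q simplex_point_def)
  qed
  also have "\<dots> = emeasure cassaigne_measure B"
    by (rule emeasure_cassaigne_measure_simplex_integral[OF assms, symmetric])
  finally show "emeasure cassaigne_measure (cassaigne_f -` B \<inter> cassaigne_f_dom) =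
      emeasure cassaigne_measure B" .
qed

end
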